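(* Let $\mathcal{S}$ be a finite collection of finite sets. If the combinatorial disjunctive constraint $\mathrm{CDC}(\mathcal{S})$ admits a junction tree $\mathcal{T}_{\mathcal{S}}$, then $\mathrm{CDC}(\mathcal{S})$ is pairwise IB-representable.
   Context: Let $\mathcal{S}=\{S^i\}_{i=1}^d$ be a finite collection of finite sets and $J:=\bigcup_{S\in\mathcal{S}}S$. For $S\subseteq J$ let $Q(S):=\{\lambda\in\mathbb{R}^J:\sum_{v\in J}\lambda_v=1,\ \lambda_v=0\ \forall v\in J\setminus S,\ \lambda\ge 0\}$. The combinatorial disjunctive constraint represented by $\mathcal{S}$ is $\lambda\in\mathrm{CDC}(\mathcal{S}):=\bigcup_{S\in\mathcal{S}}Q(S)$. $\mathrm{CDC}(\mathcal{S})$ is pairwise IB-representable if there are a $t$ and sets $L^j,R^j\subseteq J$ ($j=1,\dots,t$) with $\mathrm{CDC}(\mathcal{S})=\bigcap_{j=1}^t\left(Q(L^j)\cup Q(R^j)\right)$. For an edge $S^1S^2$ of a graph whose vertices are sets in $\mathcal{S}$, the middle set is $\mathrm{mid}(S^1S^2):=S^1\cap S^2$. A junction tree of $\mathrm{CDC}(\mathcal{S})$ is a tree $\mathcal{T}_{\mathcal{S}}=(\mathcal{S},\mathcal{E})$ with vertex set $\mathcal{S}$ such that for any $S^1,S^2\in\mathcal{S}$ the unique path $\mathcal{P}$ between $S^1$ and $S^2$ in $\mathcal{T}_{\mathcal{S}}$ satisfies $S^1\cap S^2\subseteq S$ for every vertex $S$ of $\mathcal{P}$ and $S^1\cap S^2\subseteq\mathrm{mid}(e)$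 for every edge $e$ of $\mathcal{P}$. $\mathrm{CDC}(\mathcal{S})$ admits a junction tree if such a tree exists. *)

theory Defs
  imports Complex_Main "HOL-Library.FuncSet" "Graph_Theory.Pair_Digraph"
begin

text \<open>
  \<open>\<real>\<^sup>J\<close> is rendered as \<^term>\<open>J \<rightarrow>\<^sub>E (UNIV :: real set)\<close>, the functions that take the
  dummy value \<^const>\<open>undefined\<close> outside \<open>J\<close>.
\<close>

definition simplex_face :: "'a set \<Rightarrow> 'a set \<Rightarrow> ('a \<Rightarrow> real) set" where
  "simplex_face J S =
     {x \<in> J \<rightarrow>\<^sub>E UNIV. (\<Sum>v\<in>J. x v) = 1 \<and> (\<forall>v\<in>J - S. x v = 0) \<and> (\<forall>v\<in>J. x v \<ge> 0)}"

definition CDC :: "'a set set \<Rightarrow> ('a \<Rightarrow> real) set" where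
  "CDC \<S> = (\<Union>S\<in>\<S>. simplex_face (\<Union>\<S>) S)"

text \<open>
  The ambient space is written explicitly so that the empty intersection (\<open>t = 0\<close>) is
  \<open>\<real>\<^sup>J\<close> and not the universe of the function type.
\<close>

definition pairwise_IB_representable :: "'a set set \<Rightarrow> bool" where
  "pairwise_IB_representable \<S> \<longleftrightarrow>
     (\<exists>(t :: nat) (L :: nat \<Rightarrow> 'a set) (R :: nat \<Rightarrow> 'a set).
        (\<forall>j\<in>{1..t}. L j \<subseteq> \<Union>\<S> \<and> R j \<subseteq> \<Union>\<S>) \<and>
        CDC \<S> = (\<Union>\<S> \<rightarrow>\<^sub>E UNIV) \<inter>
          (\<Inter>j\<in>{1..t}. simplex_face (\<Union>\<S>) (L j) \<union> simplex_face (\<Union>\<S>) (R j)))"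

text \<open>
  A \<^locale>\<open>pair_graph\<close> is a finite simple undirected graph, each edge \<open>uv\<close> being stored as
  the two arcs \<open>(u, v)\<close> and \<open>(v, u)\<close>.  The constant \<open>tree\<close> of the graph library forbids all
  directed cycles, including \<open>u, v, u\<close>, so no symmetric graph with an edge satisfies it;
  an undirected cycle is a \<^const>\<open>pre_digraph.cycle\<close> with at least three arcs.
  The null graph counts as a tree here, so that the empty collection is not excluded.
\<close>

definition undirected_tree :: "'v pair_pre_digraph \<Rightarrow> bool" where
  "undirected_tree T \<longleftrightarrow>
     pair_graph T \<and>
     (\<forall>u\<in>pverts T. \<forall>v\<in>pverts T. u \<rightarrow>\<^sup>*\<^bsub>with_proj T\<^esub> v) \<and>
     \<not> (\<exists>p. pre_digraph.cycle (with_proj T) p \<and> length p \<ge> 3)"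

definition mid :: "'a set \<times> 'a set \<Rightarrow> 'a set" where
  "mid e = fst e \<inter> snd e"

text \<open>
  \<^const>\<open>pre_digraph.apath\<close> describes paths without repeated vertices, given by their list of
  arcs.  In a tree there is exactly one such \<open>p\<close> between any two vertices, so quantifying
  over all of them speaks about the unique path.
\<close>

definition junction_tree :: "'a set pair_pre_digraph \<Rightarrow> 'a set set \<Rightarrow> bool" where
  "junction_tree T \<S> \<longleftrightarrow>
     undirected_tree T \<and> pverts T = \<S> \<and>
     (\<forall>S1\<in>\<S>. \<forall>S2\<in>\<S>. \<forall>p. pre_digraph.apath (with_proj T) S1 p S2 \<longrightarrow>
        (\<forall>S\<in>set (pre_digraph.awalk_verts (with_proj T) S1 p). S1 \<inter> S2 \<subseteq> S) \<and>
        (\<forall>e\<in>set p. S1 \<inter> S2 \<subseteq> mid e))"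

definition admits_junction_tree :: "'a set set \<Rightarrow> bool" where
  "admits_junction_tree \<S> \<longleftrightarrow> (\<exists>T. junction_tree T \<S>)"

end

theory Submission
  imports Defs
begin

text \<open>
  For a set \<open>T\<close> contained in no member of \<open>\<S>\<close>, call \<open>T\<close> infeasible.  If every infeasible subset
  of \<open>J\<close> contains an infeasible pair, then the constraints \<open>Q (J - {u}) \<union> Q (J - {v})\<close>, one for
  each infeasible pair \<open>u, v\<close>, describe the CDC.  This Helly property follows from medians: three
  vertices \<open>A, B, C\<close> of a junction tree have a vertex \<open>M\<close> lying on a path between any two of
  them, so \<open>M\<close> contains their pairwise intersections.  If \<open>a, b, c \<in> T\<close> are distinct and
  \<open>A, B, C\<close> contain \<open>T - {a}, T - {b}, T - {c}\<close>, then \<open>M\<close> contains \<open>T\<close>.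
\<close>

text \<open>Symmetry supplies \<open>(y, x)\<close> for each arc \<open>(x, y)\<close>, so the
  swapped arcs in reverse order lead back through the same vertices. The vertex list is recorded as
  well, so that distinctness carries over to reversed paths.\<close>

lemma (in pair_sym_digraph) awalk_rev:
  assumes "awalk u p v"
  shows "awalk v (rev (map prod.swap p)) u \<and>
    awalk_verts v (rev (map prod.swap p)) = rev (awalk_verts u p)"
  using assms
proof (induction p arbitrary: u)
  case Nil
  then show ?case by (auto simp: awalk_Nil_iff)
next
  case (Cons e es)
  obtain x y where e: "e = (x, y)" by fastforce
  from Cons.prems e have "(x, y) \<in> parcs G" and u: "u = x" and es: "awalk y es v"
    by (auto simp: awalk_Cons_iff)
  then have yx: "(y, x) \<in> parcs G"
    using sym_arcs by (auto simp: symmetric_def dest: symD)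
  let ?r = "rev (map prod.swap es)"
  have IH: "awalk v ?r y" "awalk_verts v ?r = rev (awalk_verts y es)"
    using Cons.IH[OF es] by auto
  have "awalk y [(y, x)] x"
    using yx by (auto simp: awalk_simps dest: wellformed)
  then have w: "awalk v (?r @ [(y, x)]) x"
    using IH(1) by (rule awalk_appendI[rotated])
  then have "awalk_verts v (?r @ [(y, x)]) = awalk_verts v ?r @ [x]"
    by (subst awalk_verts_append) auto
  then show ?case using w IH e u by simp
qed

lemma (in pair_sym_digraph) apath_rev:
  assumes "apath u p v"
  shows "apath v (rev (map prod.swap p)) u"
    and "awalk_verts v (rev (map prod.swap p)) = rev (awalk_verts u p)"
  using awalk_rev[of u p v] assms by (auto simp: apath_def)

text \<open>Only \<open>m\<close> can be shared by the two paths, and it starts the distinct list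
  \<open>awalk_verts m r\<close>. The tail of that list therefore avoids \<open>m\<close>, hence
  every vertex of \<open>q\<close>.\<close>

lemma (in wf_digraph) apath_appendI:
  assumes q: "apath u q m" and r: "apath m r v"
    and meet: "set (awalk_verts u q) \<inter> set (awalk_verts m r) \<subseteq> {m}"
  shows "apath u (q @ r) v"
proof -
  have last: "awlast u q = m" and hd: "awhd m r = m"
    using q r by (auto simp: apath_def)
  have "awalk_verts m r = m # tl (awalk_verts m r)"
    using hd by (metis awalk_verts_non_Nil list.collapse)
  moreover have "distinct (awalk_verts m r)"
    using r by (simp add: apath_def)
  ultimately have "m \<notin> set (tl (awalk_verts m r))"
      "set (tl (awalk_verts m r)) \<subseteq> set (awalk_verts m r)"
    by (metis distinct.simps(2), metis set_subset_Cons)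
  then show ?thesis
    using q r meet last by (auto simp: apath_append_iff)
qed

text \<open>Cut the path at its first vertex in \<open>X\<close>; no earlier vertex of the path lies
  in \<open>X\<close>.\<close>

lemma (in wf_digraph) apath_first_hit:
  assumes "apath w r x" and "x \<in> X"
  obtains q m where "apath w q m" "set (awalk_verts w q) \<inter> X = {m}"
proof -
  \<comment> \<open>The last conjunct strengthens the induction: \<open>w\<close> is not on the rest
    of the path, hence not on the prefix found there, and prepending \<open>e\<close> keeps the
    vertices distinct.\<close>
  have "\<exists>q m. apath w q m \<and> set (awalk_verts w q) \<inter> X = {m} \<and>
      set (awalk_verts w q) \<subseteq> set (awalk_verts w r)"
    using assms
  proof (induction r arbitrary: w)
    case Nil
    then show ?case by (intro exI[of _ "[]"] exI[of _ w]) (auto simp: apath_Nil_iff)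
  next
    case (Cons e es)
    show ?case
    proof (cases "w \<in> X")
      case True
      then show ?thesis
        using Cons.prems
        by (intro exI[of _ "[]"] exI[of _ w]) (auto simp: apath_simps)
    next
      case False
      from Cons.prems have e: "e \<in> arcs G" "tail G e = w" "apath (head G e) es x"
          "w \<notin> set (awalk_verts (head G e) es)"
        by (auto simp: apath_Cons_iff)
      with Cons.IH[OF e(3) Cons.prems(2)] obtain q m where
        "apath (head G e) q m" "set (awalk_verts (head G e) q) \<inter> X = {m}"
        "set (awalk_verts (head G e) q) \<subseteq> set (awalk_verts (head G e) es)"
        by blast
      then show ?thesis
        using e False
        by (intro exI[of _ "e # q"] exI[of _ m]) (auto simp: apath_Cons_iff)
    qed
  qed
  then show ?thesis using that by blast
qed

text \<open>Fix a path \<open>p\<close> from \<open>u\<close> to \<open>v\<close> and walk from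
  \<open>w\<close> towards \<open>u\<close> until \<open>p\<close> is first met, at
  \<open>m\<close>. From \<open>m\<close>, follow \<open>p\<close> backwards to \<open>u\<close> or
  forwards to \<open>v\<close>.\<close>

lemma (in pair_sym_digraph) apath_median:
  assumes uv: "u \<rightarrow>\<^sup>*\<^bsub>with_proj G\<^esub> v" and wu: "w \<rightarrow>\<^sup>*\<^bsub>with_proj G\<^esub> u"
  obtains m p q r where "apath u p v" "m \<in> set (awalk_verts u p)"
    "apath w q u" "m \<in> set (awalk_verts w q)"
    "apath w r v" "m \<in> set (awalk_verts w r)"
proof -
  obtain p where p: "apath u p v" using uv reachable_apath by blast
  obtain s where s: "apath w s u" using wu reachable_apath by blast
  have "u \<in> set (awalk_verts u p)" using p by (rule hd_in_awalk_verts)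
  then obtain q m where q: "apath w q m"
      and qm: "set (awalk_verts w q) \<inter> set (awalk_verts u p) = {m}"
    using apath_first_hit[OF s] by blast
  have mp: "m \<in> set (awalk_verts u p)" and mq: "m \<in> set (awalk_verts w q)"
    using qm by auto
  obtain p1 p2 where pp: "p = p1 @ p2" and "awalk u p1 m" "awalk m p2 v"
    using awalk_decomp[OF awalkI_apath[OF p] mp] by blast
  then have p1: "apath u p1 m" and p2: "apath m p2 v"
    using p by (auto simp: apath_append_iff)
  have sub: "set (awalk_verts u p) = set (awalk_verts u p1) \<union> set (awalk_verts m p2)"
    unfolding pp using set_awalk_verts_append \<open>awalk u p1 m\<close> \<open>awalk m p2 v\<close> by blast
  let ?r1 = "rev (map prod.swap p1)"
  \<comment> \<open>Both continuations stay on \<open>p\<close>, which \<open>q\<close> meets only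
    in \<open>m\<close>, so the concatenations are paths.\<close>
  have 1: "apath w (q @ ?r1) u"
    using apath_rev[OF p1] qm sub by (intro apath_appendI[OF q]) auto
  have 2: "apath w (q @ p2) v"
    using qm sub by (intro apath_appendI[OF q p2]) auto
  have "m \<in> set (awalk_verts w (q @ r))" if "apath w (q @ r) x" for r x
    using that mq by (auto simp: apath_def awalk_verts_append)
  then show ?thesis using that p mp 1 2 by blast
qed

lemma junction_tree_median:
  assumes "junction_tree T \<S>" and "A \<in> \<S>" "B \<in> \<S>" "C \<in> \<S>"
  shows "\<exists>M\<in>\<S>. A \<inter> B \<subseteq> M \<and> B \<inter> C \<subseteq> M \<and> A \<inter> C \<subseteq> M"
proof -
  from assms have T: "pair_graph T" and V: "pverts T = \<S>"
    and conn: "A \<rightarrow>\<^sup>*\<^bsub>with_proj T\<^esub> B" "C \<rightarrow>\<^sup>*\<^bsub>with_proj T\<^esub> A"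
    by (auto simp: junction_tree_def undirected_tree_def)
  interpret pair_graph T by (rule T)
  \<comment> \<open>\<open>junction_tree\<close> speaks of every \<open>apath\<close>, so its vertex
    condition applies directly to the three paths given by \<open>apath_median\<close>.\<close>
  have path: "S1 \<inter> S2 \<subseteq> M" if "apath S1 p S2" "M \<in> set (awalk_verts S1 p)"
      "S1 \<in> \<S>" "S2 \<in> \<S>" for S1 S2 p M
  proof -
    have "\<forall>S1\<in>\<S>. \<forall>S2\<in>\<S>. \<forall>p. apath S1 p S2 \<longrightarrow>
        (\<forall>S\<in>set (awalk_verts S1 p). S1 \<inter> S2 \<subseteq> S)"
      using assms(1) by (simp add: junction_tree_def)
    then show ?thesis using that by meson
  qed
  obtain M p q r where M: "apath A p B" "M \<in> set (awalk_verts A p)"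
    "apath C q A" "M \<in> set (awalk_verts C q)"
    "apath C r B" "M \<in> set (awalk_verts C r)"
    using apath_median[OF conn] by metis
  have "M \<in> \<S>"
    using awalkI_apath[OF M(1)] M(2) V by (metis awalkE' subsetD with_proj_simps(1))
  moreover have "A \<inter> B \<subseteq> M" by (rule path[OF M(1,2) assms(2,3)])
  moreover have "C \<inter> B \<subseteq> M" by (rule path[OF M(5,6) assms(4,3)])
  moreover have "C \<inter> A \<subseteq> M" by (rule path[OF M(3,4) assms(4,2)])
  ultimately show ?thesis by (simp add: Int_commute bexI[of _ M])
qed

lemma median_Helly:
  assumes median: "\<And>A B C. A \<in> \<S> \<Longrightarrow> B \<in> \<S> \<Longrightarrow> C \<in> \<S> \<Longrightarrow>
      \<exists>M\<in>\<S>. A \<inter> B \<subseteq> M \<and> B \<inter> C \<subseteq> M \<and> A \<inter> C \<subseteq> M"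
    and "finite T" "T \<noteq> {}"
    and "\<And>u v. u \<in> T \<Longrightarrow> v \<in> T \<Longrightarrow> \<exists>S\<in>\<S>. u \<in> S \<and> v \<in> S"
  shows "\<exists>S\<in>\<S>. T \<subseteq> S"
  using assms(2-)
proof (induction T rule: finite_psubset_induct)
  case (psubset T)
  \<comment> \<open>The second point \<open>y\<close> keeps \<open>T - {x}\<close> nonempty, as the
    induction hypothesis requires.\<close>
  have step: "\<exists>S\<in>\<S>. T - {x} \<subseteq> S" if "x \<in> T" "y \<in> T" "x \<noteq> y" for x y
    using that psubset.prems by (intro psubset.IH) auto
  obtain a where a: "a \<in> T" using psubset.prems(1) by blast
  show ?case
  proof (cases "\<exists>b c. b \<in> T \<and> c \<in> T \<and> a \<noteq> b \<and> a \<noteq> c \<and> b \<noteq> c")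
    case True
    then obtain b c where bc: "b \<in> T" "c \<in> T" "a \<noteq> b" "a \<noteq> c" "b \<noteq> c" by blast
    obtain A where A: "A \<in> \<S>" "T - {a} \<subseteq> A" using step a bc by blast
    obtain B where B: "B \<in> \<S>" "T - {b} \<subseteq> B" using step a bc by blast
    obtain C where C: "C \<in> \<S>" "T - {c} \<subseteq> C" using step a bc by blast
    obtain M where "M \<in> \<S>" "A \<inter> B \<subseteq> M" "B \<inter> C \<subseteq> M" "A \<inter> C \<subseteq> M"
      using median A(1) B(1) C(1) by meson
    \<comment> \<open>An element of \<open>T\<close> equals at most one of \<open>a\<close>,
      \<open>b\<close>, \<open>c\<close>, so it lies in at least two of \<open>A\<close>,
      \<open>B\<close>, \<open>C\<close>.\<close>
    moreover have "T \<subseteq> (A \<inter> B) \<union> (B \<inter> C) \<union> (A \<inter> C)"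
      using A(2) B(2) C(2) bc by auto
    ultimately have "T \<subseteq> M" by auto
    then show ?thesis using \<open>M \<in> \<S>\<close> by (rule bexI)
  next
    case small: False
    \<comment> \<open>The choice \<open>b = a\<close> is allowed, so the pair condition also settles
      a singleton \<open>T\<close>.\<close>
    have "\<exists>b\<in>T. T \<subseteq> {a, b}"
    proof (cases "T = {a}")
      case False
      then obtain b where "b \<in> T" "b \<noteq> a" using a by blast
      then show ?thesis using small by (intro bexI[of _ b]) auto
    qed simp
    then obtain b where "b \<in> T" "T \<subseteq> {a, b}" by blast
    moreover obtain S where "S \<in> \<S>" "a \<in> S" "b \<in> S"
      using psubset.prems(2)[OF a \<open>b \<in> T\<close>] by blast
    ultimately have "T \<subseteq> S" by auto
    then show ?thesis using \<open>S \<in> \<S>\<close> by (rule bexI)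
  qed
qed

text \<open>
  The additional pair \<open>(J, J)\<close> enforces membership in the full simplex, which is needed when
  there is no infeasible pair.
\<close>
lemma pairwise_IB_representableI:
  assumes "finite (\<Union>\<S>)"
    and Helly: "\<And>T. T \<subseteq> \<Union>\<S> \<Longrightarrow> T \<noteq> {} \<Longrightarrow>
      (\<And>u v. u \<in> T \<Longrightarrow> v \<in> T \<Longrightarrow> \<exists>S\<in>\<S>. u \<in> S \<and> v \<in> S) \<Longrightarrow> \<exists>S\<in>\<S>. T \<subseteq> S"
  shows "pairwise_IB_representable \<S>"
proof -
  define J where "J = \<Union>\<S>"
  define I where "I = {(u, v) \<in> J \<times> J. \<not> (\<exists>S\<in>\<S>. u \<in> S \<and> v \<in> S)}"
  define P where "P = insert (J, J) ((\<lambda>(u, v). (J - {u}, J - {v})) ` I)"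
  have "finite J" using assms(1) by (simp add: J_def)
  moreover have "I \<subseteq> J \<times> J" by (auto simp: I_def)
  ultimately have "finite I" by (meson finite_SigmaI finite_subset)
  then have "finite P" by (simp add: P_def)
  \<comment> \<open>The definition indexes the constraints by \<open>{1..t}\<close>; enumerating the
    finite set \<open>P\<close> gives \<open>t = card P\<close>.\<close>
  then obtain h where h: "bij_betw h {1..card P} P"
    using ex_bij_betw_nat_finite_1 by blast
  then have img: "h ` {1..card P} = P" by (simp add: bij_betw_def)
  have mono: "simplex_face J A \<subseteq> simplex_face J B" if "A \<subseteq> B" for A B
    using that by (auto simp: simplex_face_def)
  let ?Q = "simplex_face J"
  have "(\<Union>S\<in>\<S>. ?Q S) = (J \<rightarrow>\<^sub>E UNIV) \<inter> (\<Inter>(L, R)\<in>P. ?Q L \<union> ?Q R)"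
  proof (intro equalityI subsetI)
    fix x assume "x \<in> (\<Union>S\<in>\<S>. ?Q S)"
    then obtain S where S: "S \<in> \<S>" "x \<in> ?Q S" by blast
    have "x \<in> ?Q L \<union> ?Q R" if "(L, R) \<in> P" for L R
    proof -
      \<comment> \<open>A member of \<open>\<S>\<close> cannot contain both points of an infeasible
        pair, so it avoids one of them.\<close>
      have "S \<subseteq> L \<or> S \<subseteq> R"
        using that S(1) by (auto simp: P_def I_def J_def)
      then show ?thesis using mono S(2) by blast
    qed
    moreover have "x \<in> J \<rightarrow>\<^sub>E UNIV" using S(2) by (simp add: simplex_face_def)
    ultimately show "x \<in> (J \<rightarrow>\<^sub>E UNIV) \<inter> (\<Inter>(L, R)\<in>P. ?Q L \<union> ?Q R)" by blast
  next
    fix x assume "x \<in> (J \<rightarrow>\<^sub>E UNIV) \<inter> (\<Inter>(L, R)\<in>P. ?Q L \<union> ?Q R)"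
    then have x: "x \<in> ?Q L \<union> ?Q R" if "(L, R) \<in> P" for L R using that by blast
    have xJ: "x \<in> ?Q J" using x[of J J] by (simp add: P_def)
    \<comment> \<open>\<open>T\<close> is the support of \<open>x\<close>: a point of the full
      simplex lies in \<open>?Q S\<close> exactly when \<open>T \<subseteq> S\<close>.\<close>
    define T where "T = {v \<in> J. x v \<noteq> 0}"
    have "\<exists>S\<in>\<S>. u \<in> S \<and> v \<in> S" if "u \<in> T" "v \<in> T" for u v
    proof (rule ccontr)
      assume "\<not> ?thesis"
      then have "(u, v) \<in> I" using that by (auto simp: I_def T_def)
      then have "(J - {u}, J - {v}) \<in> P" by (auto simp: P_def)
      \<comment> \<open>The constraint of the pair forces \<open>x u = 0\<close> or
        \<open>x v = 0\<close>, although both points are in the support.\<close>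
      from x[OF this] that show False by (auto simp: simplex_face_def T_def)
    qed
    moreover have "T \<noteq> {}"
    proof
      assume "T = {}"
      then have "(\<Sum>v\<in>J. x v) = 0" by (intro sum.neutral) (auto simp: T_def)
      then show False using xJ by (simp add: simplex_face_def)
    qed
    moreover have "T \<subseteq> \<Union>\<S>" by (auto simp: T_def J_def)
    ultimately have "\<exists>S\<in>\<S>. T \<subseteq> S" by (intro Helly)
    then obtain S where S: "S \<in> \<S>" "T \<subseteq> S" by (rule bexE)
    have "x v = 0" if "v \<in> J - S" for v
      using that S(2) by (auto simp: T_def)
    then have "x \<in> ?Q S"
      using xJ by (simp add: simplex_face_def)
    then show "x \<in> (\<Union>S\<in>\<S>. ?Q S)" using S(1) by (rule UN_I[rotated])
  qed
  also have "(\<Inter>(L, R)\<in>P. ?Q L \<union> ?Q R) =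
      (\<Inter>j\<in>{1..card P}. ?Q (fst (h j)) \<union> ?Q (snd (h j)))"
    by (subst img[symmetric]) (simp add: case_prod_beta)
  finally have "CDC \<S> = (J \<rightarrow>\<^sub>E UNIV) \<inter>
      (\<Inter>j\<in>{1..card P}. ?Q (fst (h j)) \<union> ?Q (snd (h j)))"
    by (simp add: CDC_def J_def)
  moreover have "fst (h j) \<subseteq> J \<and> snd (h j) \<subseteq> J" if "j \<in> {1..card P}" for j
  proof -
    have "h j \<in> P" using that img by blast
    then show ?thesis by (auto simp: P_def)
  qed
  ultimately show ?thesis
    unfolding pairwise_IB_representable_def J_def
    by (rule_tac x = "card P" in exI, rule_tac x = "\<lambda>j. fst (h j)" in exI,
        rule_tac x = "\<lambda>j. snd (h j)" in exI) simp
qed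

theorem theorem1:
  fixes \<S> :: "'a set set"
  assumes "finite \<S>"
    and "\<And>S. S \<in> \<S> \<Longrightarrow> finite S"
    and "admits_junction_tree \<S>"
  shows "pairwise_IB_representable \<S>"
proof (rule pairwise_IB_representableI)
  show fin: "finite (\<Union>\<S>)" using assms(1,2) by blast
  obtain G where G: "junction_tree G \<S>"
    using assms(3) by (auto simp: admits_junction_tree_def)
  fix T
  assume "T \<subseteq> \<Union>\<S>" "T \<noteq> {}"
    and "\<And>u v. u \<in> T \<Longrightarrow> v \<in> T \<Longrightarrow> \<exists>S\<in>\<S>. u \<in> S \<and> v \<in> S"
  then show "\<exists>S\<in>\<S>. T \<subseteq> S"
    using median_Helly[OF junction_tree_median[OF G]] finite_subset[OF _ fin] by blast
qed

end
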